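(* Let $\mathcal{H}$ be a Hilbert space of dimension at least two, $R>0$, $A\subset\mathcal{H}$ an $R$-proximally smooth set, and $x_0,x_1\in A$ two distinct points with $|x_0-x_1|<2R$. Let $S_i=\{j/2^i: j=0,1,\dots,2^i\}$ for $i\ge0$. Define $f$ on $\bigcup_i S_i$ recursively ("slice-bisection"): $f(0)=x_0$, $f(1)=x_1$, and for every $i\ge1$ and $j\in\{1,\dots,2^{i-1}\}$ let $f\left(\frac{2j-1}{2^i}\right)$ be the slice-projection onto $A$ of the midpoint of the segment $\left[f\left(\frac{j-1}{2^{i-1}}\right),f\left(\frac{j}{2^{i-1}}\right)\right]$ with respect to that segment. Then this procedure is correct: $f$ is well defined, it extends continuously to $[0,1]$, and the extension is a rectifiable curve $f\colon[0,1]\to A\cap D_R[x_0,x_1]$ with $f(0)=x_0$, $f(1)=x_1$, of length at most $2R\arcsin\frac{|x_0-x_1|}{2R}$.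
   Context: $\operatorname{dist}(x,A)=\inf_{y\in A}|x-y|$. A set $A$ is $R$-proximally smooth if it is closed and $x\mapsto \operatorname{dist}(x,A)$ is continuously differentiable on $\{x: 0<\operatorname{dist}(x,A)<R\}$. For $|a-b|\le2R$, the strongly convex segment $D_R[a,b]$ is the intersection of all closed balls of radius $R$ containing both $a$ and $b$. Slice-projection: for distinct points $u,v\in\mathcal{H}$ and a point $x\in[u,v]$, let $H$ be the hyperplane through $x$ orthogonal to $v-u$; a slice-projection of $x$ onto $A$ with respect to $[u,v]$ is any point of $A\cap H$ nearest to $x$. (Well-definedness of $f$ includes that consecutive values are distinct and that the required slice-projections exist and are unique.) Length of a curve is its total variation. *)

theory Defs
  imports "HOL-Analysis.Analysis"
begin

text \<open>A Hilbert space is a type of sorts \<open>real_inner\<close> and \<open>complete_space\<close>, the distance to a set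
  is \<open>infdist\<close>. Frechet derivatives are bundled as bounded linear functions, so continuity of
  \<open>d'\<close> is continuity with respect to the operator norm.\<close>

definition proximally_smooth :: "real \<Rightarrow> 'a::{real_inner,complete_space} set \<Rightarrow> bool" where
  "proximally_smooth R A \<longleftrightarrow>
     closed A \<and>
     (\<exists>d' :: 'a \<Rightarrow> 'a \<Rightarrow>\<^sub>L real.
        (\<forall>x. 0 < infdist x A \<and> infdist x A < R \<longrightarrow>
           ((\<lambda>y. infdist y A) has_derivative blinfun_apply (d' x)) (at x)) \<and>
        continuous_on {x. 0 < infdist x A \<and> infdist x A < R} d')"

definition strongly_convex_segment :: "real \<Rightarrow> 'a::metric_space \<Rightarrow> 'a \<Rightarrow> 'a set" where
  "strongly_convex_segment R a b = \<Inter> {cball c R | c. a \<in> cball c R \<and> b \<in> cball c R}"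

text \<open>The set \<open>slice_hyperplane u v x\<close> is a hyperplane only if \<open>u \<noteq> v\<close>.\<close>

definition slice_hyperplane :: "'a::real_inner \<Rightarrow> 'a \<Rightarrow> 'a \<Rightarrow> 'a set" where
  "slice_hyperplane u v x = {y. (y - x) \<bullet> (v - u) = 0}"

definition slice_projection :: "'a::real_inner set \<Rightarrow> 'a \<Rightarrow> 'a \<Rightarrow> 'a \<Rightarrow> 'a \<Rightarrow> bool" where
  "slice_projection A u v x p \<longleftrightarrow> is_arg_min (dist x) (\<lambda>q. q \<in> A \<inter> slice_hyperplane u v x) p"

definition dyadic_grid :: "nat \<Rightarrow> real set" where
  "dyadic_grid i = {real j / 2 ^ i | j. j \<le> 2 ^ i}"

text \<open>The function \<open>f\<close> is a successful run of the slice-bisection procedure; only its values on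
  \<open>\<Union>i. dyadic_grid i\<close> matter. Every step requires the two endpoints of the bisected segment to be
  distinct and the slice-projection of its midpoint to exist and to be unique.\<close>

definition slice_bisection :: "'a::real_inner set \<Rightarrow> 'a \<Rightarrow> 'a \<Rightarrow> (real \<Rightarrow> 'a) \<Rightarrow> bool" where
  "slice_bisection A x0 x1 f \<longleftrightarrow>
     f 0 = x0 \<and> f 1 = x1 \<and>
     (\<forall>i\<ge>1. \<forall>j\<in>{1..2 ^ (i - 1)}.
        let u = f ((real j - 1) / 2 ^ (i - 1));
            v = f (real j / 2 ^ (i - 1))
        in u \<noteq> v \<and>
           (\<exists>!p. slice_projection A u v (midpoint u v) p) \<and>
           slice_projection A u v (midpoint u v) (f ((2 * real j - 1) / 2 ^ i)))"

text \<open>Total variation of \<open>f\<close> on \<open>[a, b]\<close>, the supremum over all finite chains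
  \<open>t 0 \<le> \<dots> \<le> t n\<close> in \<open>[a, b]\<close>; the value is infinite if \<open>f\<close> is not rectifiable.\<close>

definition curve_length :: "(real \<Rightarrow> 'a::metric_space) \<Rightarrow> real \<Rightarrow> real \<Rightarrow> ennreal" where
  "curve_length f a b =
     (SUP (n, t) \<in> {(n :: nat, t :: nat \<Rightarrow> real).
                      (\<forall>i\<le>n. t i \<in> {a..b}) \<and> (\<forall>i<n. t i \<le> t (Suc i))}.
        \<Sum>i<n. ennreal (dist (f (t i)) (f (t (Suc i)))))"

end

theory Submission
  imports Defs
begin

text \<open>Differentiability of the distance function at a point of the tube \<open>0 < d < R\<close> forces minimizing
  sequences to converge, hence yields nearest points, and makes the slope of \<open>d\<close> equal to one.
  With Ekeland's variational principle the slope condition gives points at distance \<open>r\<close> from \<open>x\<close>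
  where \<open>d\<close> has grown by almost \<open>r\<close>; by uniform convexity they lie close to the normal ray
  through \<open>x\<close>, so \<open>d\<close> grows with slope one along this ray up to \<open>R\<close>. This is the inequality
  \<open>2 R \<langle>x - p, a - p\<rangle> \<le> d(x) |a - p|\<^sup>2\<close> for a nearest point \<open>p\<close> of \<open>x\<close> and \<open>a \<in> A\<close>. It makes the
  projection Lipschitz on a segment \<open>[u, v]\<close>, so by the intermediate value theorem some \<open>z \<in> [u, v]\<close>
  is projected into the bisecting hyperplane; the same inequality at \<open>z\<close> shows that this projection
  is the unique slice-projection of the midpoint and that its height over the chord is at most the
  sagitta of the arc of radius \<open>R\<close>. Hence each bisection at least halves the angle \<open>\<phi>\<close> in the bound
  \<open>|u - v| \<le> 2 R sin \<phi>\<close>, and \<open>f\<close> is Lipschitz with constant \<open>2 R arcsin (|x0 - x1| / (2 R))\<close>.\<close>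

section \<open>Derivatives of the distance function and nearest points\<close>

lemma infdist_derivative_le:
  fixes A :: "'a::real_normed_vector set"
  assumes "((\<lambda>y. infdist y A) has_derivative D) (at x)"
  shows "\<bar>D w\<bar> \<le> norm w"
proof (rule field_le_epsilon)
  fix e :: real assume "e > 0"
  define e' where "e' = e / (norm w + 1)"
  have e': "e' > 0" "e' * norm w \<le> e"
    using \<open>e > 0\<close> by (auto simp: e'_def field_simps add_pos_nonneg)
  interpret D: bounded_linear D using assms by (rule has_derivative_bounded_linear)
  obtain h where h: "h > 0"
    "\<And>y. norm (y - x) < h \<Longrightarrow> \<bar>infdist y A - infdist x A - D (y - x)\<bar> \<le> e' * norm (y - x)"
    using assms e'(1) unfolding has_derivative_at_alt by (metis real_norm_def)
  define t where "t = h / (2 * (norm w + 1))"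
  have t: "t > 0" "t * norm w < h"
    using h(1) by (auto simp: t_def field_simps add_pos_nonneg add_nonneg_pos)
  have "\<bar>infdist (x + t *\<^sub>R w) A - infdist x A - D (t *\<^sub>R w)\<bar> \<le> e' * (t * norm w)"
    using h(2)[of "x + t *\<^sub>R w"] t by simp
  moreover have "\<bar>infdist (x + t *\<^sub>R w) A - infdist x A\<bar> \<le> t * norm w"
    using infdist_triangle_abs[of "x + t *\<^sub>R w" A x] t by (simp add: dist_norm)
  ultimately have "\<bar>D (t *\<^sub>R w)\<bar> \<le> t * norm w + e' * (t * norm w)" by linarith
  also have "\<dots> = t * (norm w + e' * norm w)" by (simp add: algebra_simps)
  finally have "t * \<bar>D w\<bar> \<le> t * (norm w + e' * norm w)"
    using t by (simp only: D.scaleR real_scaleR_def abs_mult abs_of_pos)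
  then have "\<bar>D w\<bar> \<le> norm w + e' * norm w" using t by simp
  then show "\<bar>D w\<bar> \<le> norm w + e" using e' by linarith
qed

text \<open>Moving from \<open>x\<close> a fraction \<open>t\<close> of the way to an almost nearest
  \<open>a\<close> leaves a distance of at most \<open>(1 - t) * dist x a\<close>, so the slope
  towards \<open>a\<close> is close to that of a straight approach. The estimate speaks of almost
  nearest points because it serves to produce nearest ones.\<close>

lemma infdist_derivative_near_minimizer:
  fixes A :: "'a::real_normed_vector set"
  assumes D: "((\<lambda>y. infdist y A) has_derivative D) (at x)" and e: "e > 0"
  obtains \<delta> where "\<delta> > 0" "\<delta> \<le> 1"
    "\<And>a. a \<in> A \<Longrightarrow> dist x a < infdist x A + \<delta> \<Longrightarrow> D (a - x) \<le> - infdist x A + e"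
proof -
  define d where "d = infdist x A"
  have d0: "d \<ge> 0" by (simp add: d_def infdist_nonneg)
  define e' where "e' = e / (2 * (d + 1))"
  have e': "e' > 0" "e' * (d + 1) = e / 2" using e d0 by (auto simp: e'_def field_simps)
  interpret D: bounded_linear D using D by (rule has_derivative_bounded_linear)
  obtain h where h: "h > 0"
    "\<And>y. norm (y - x) < h \<Longrightarrow> \<bar>infdist y A - d - D (y - x)\<bar> \<le> e' * norm (y - x)"
    using D e'(1) unfolding has_derivative_at_alt d_def by (metis real_norm_def)
  define t where "t = min 1 (h / 2 / (d + 1))"
  have t: "t > 0" "t \<le> 1" using h(1) d0 by (auto simp: t_def)
  have "t * (d + 1) \<le> h / 2 / (d + 1) * (d + 1)" using d0 by (intro mult_right_mono) (auto simp: t_def)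
  also have "\<dots> = h / 2" using d0 by (metis add_nonneg_pos eq_divide_eq less_irrefl zero_less_one)
  also have "\<dots> < h" using h(1) by simp
  finally have th: "t * (d + 1) < h" .
  \<comment> \<open>The step \<open>t\<close> is fixed before \<open>\<delta>\<close> because the
    excess \<open>r - d < \<delta>\<close> gets divided by \<open>t\<close>: it costs
    \<open>e / 2\<close>, and the linearization error \<open>e' * r\<close> costs the other
    half.\<close>
  define \<delta> where "\<delta> = min 1 (t * e / 2)"
  have \<delta>: "\<delta> > 0" "\<delta> \<le> 1" "\<delta> \<le> t * e / 2" using t e by (auto simp: \<delta>_def)
  have "D (a - x) \<le> - d + e" if a: "a \<in> A" "dist x a < d + \<delta>" for a
  proof -
    define r where "r = norm (a - x)"
    have r: "d \<le> r" "r < d + \<delta>"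
      using a infdist_le[OF a(1), of x] by (auto simp: r_def d_def dist_norm norm_minus_commute)
    have "t * r \<le> t * (d + 1)" using r \<delta> t by (intro mult_left_mono) auto
    then have "t * r < h" using th by linarith
    then have "\<bar>infdist (x + t *\<^sub>R (a - x)) A - d - t * D (a - x)\<bar> \<le> e' * (t * r)"
      using h(2)[of "x + t *\<^sub>R (a - x)"] t(1) by (simp add: D.scaleR r_def)
    moreover have "infdist (x + t *\<^sub>R (a - x)) A \<le> (1 - t) * r"
    proof -
      have "x + t *\<^sub>R (a - x) - a = - ((1 - t) *\<^sub>R (a - x))" by (simp add: algebra_simps)
      then have "dist (x + t *\<^sub>R (a - x)) a = (1 - t) * r"
        unfolding dist_norm r_def using t by (metis norm_minus_cancel norm_scaleR abs_of_nonneg diff_ge_0_iff_ge)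
      then show ?thesis using infdist_le[OF a(1)] by metis
    qed
    ultimately have "t * D (a - x) \<le> (r - d) - t * r + t * (e' * r)" by (auto simp: abs_le_iff algebra_simps)
    also have "\<dots> \<le> t * e / 2 - t * d + t * (e' * (d + 1))"
    proof -
      have "t * (e' * r) \<le> t * (e' * (d + 1))" using r \<delta> t e' by (intro mult_left_mono) auto
      moreover have "t * d \<le> t * r" using r t by simp
      ultimately show ?thesis using r \<delta> by linarith
    qed
    also have "\<dots> = t * (- d + e)" unfolding e' by (simp add: algebra_simps)
    finally show ?thesis using t by simp
  qed
  then show thesis using that \<delta> d_def by blast
qed

definition nearest_point :: "'a::metric_space set \<Rightarrow> 'a \<Rightarrow> 'a \<Rightarrow> bool" where
  "nearest_point A x p \<longleftrightarrow> p \<in> A \<and> dist x p = infdist x A"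

text \<open>\<open>p\<close> is an almost nearest point for every tolerance, so the 1-Lipschitz
  bound of \<open>infdist_derivative_le\<close> is attained in the direction
  \<open>x - p\<close>.\<close>

lemma nearest_point_derivative:
  fixes A :: "'a::real_normed_vector set"
  assumes D: "((\<lambda>y. infdist y A) has_derivative D) (at x)" and p: "nearest_point A x p"
  shows "D (x - p) = norm (x - p)"
proof (rule antisym)
  interpret D: bounded_linear D using D by (rule has_derivative_bounded_linear)
  show "D (x - p) \<le> norm (x - p)" using infdist_derivative_le[OF D, of "x - p"] by linarith
  have "D (p - x) \<le> - norm (x - p)"
  proof (rule field_le_epsilon)
    fix e :: real assume "e > 0"
    then show "D (p - x) \<le> - norm (x - p) + e"
      using infdist_derivative_near_minimizer[OF D] p unfolding nearest_point_def
      by (metis add.commute dist_norm less_add_same_cancel2)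
  qed
  then show "norm (x - p) \<le> D (x - p)" by (simp add: D.diff)
qed

text \<open>In place of compactness, the derivative makes a minimizing sequence Cauchy: for two
  almost nearest points \<open>D (u + v)\<close> is close to \<open>- 2 * d\<close>, so
  \<open>norm (u + v)\<close> is at least almost \<open>2 * d\<close>, and the parallelogram law
  forces \<open>u - v\<close> to be small.\<close>

lemma nearest_point_exists:
  fixes A :: "'a::{real_inner,complete_space} set"
  assumes D: "((\<lambda>y. infdist y A) has_derivative D) (at x)" and A: "closed A" "A \<noteq> {}"
  obtains p where "nearest_point A x p"
proof -
  define d where "d = infdist x A"
  have d0: "d \<ge> 0" by (simp add: d_def infdist_nonneg)
  interpret D: bounded_linear D using D by (rule has_derivative_bounded_linear)
  have "\<exists>a\<in>A. dist x a < d + inverse (Suc n)" for n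
  proof (rule ccontr)
    assume "\<not> (\<exists>a\<in>A. dist x a < d + inverse (Suc n))"
    then have "d + inverse (Suc n) \<le> infdist x A"
      using A by (auto simp: infdist_def intro!: cINF_greatest)
    then show False unfolding d_def by simp
  qed
  then obtain a where a: "\<And>n. a n \<in> A" "\<And>n. dist x (a n) < d + inverse (Suc n)" by metis
  have ad: "(\<lambda>n. dist x (a n)) \<longlonglongrightarrow> d"
  proof (rule real_tendsto_sandwich)
    show "\<forall>\<^sub>F n in sequentially. d \<le> dist x (a n)" using infdist_le[OF a(1)] by (simp add: d_def)
    show "\<forall>\<^sub>F n in sequentially. dist x (a n) \<le> d + inverse (Suc n)" using a(2) by (simp add: less_imp_le)
    show "(\<lambda>n. d + inverse (real (Suc n))) \<longlonglongrightarrow> d" using LIMSEQ_inverse_real_of_nat_add[of d] by simp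
  qed auto
  have "Cauchy a"
  proof (rule metric_CauchyI)
    fix e :: real assume e: "e > 0"
    \<comment> \<open>The parallelogram law will bound the square of \<open>norm (u - v)\<close> by
      \<open>c' * (16 * d + 8 * c')\<close>; this \<open>c\<close> keeps it below the square of
      \<open>e\<close> as soon as \<open>c' \<le> 1\<close> and \<open>c' \<le> c\<close>.\<close>
    define c where "c = e\<^sup>2 / (16 * (d + 1) + 4)"
    have cp: "c > 0" using e d0 by (simp add: c_def add_nonneg_pos)
    define c' where "c' = min 1 c"
    have c': "c' > 0" "c' \<le> 1" "c' \<le> c" using cp by (auto simp: c'_def)
    obtain \<delta> where \<delta>: "\<delta> > 0" "\<And>b. b \<in> A \<Longrightarrow> dist x b < d + \<delta> \<Longrightarrow> D (b - x) \<le> - d + c'"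
      using infdist_derivative_near_minimizer[OF D \<open>c' > 0\<close>] unfolding d_def by metis
    have "\<forall>\<^sub>F n in sequentially. dist x (a n) < d + min \<delta> c'"
      using order_tendstoD(2)[OF ad, of "d + min \<delta> c'"] \<delta>(1) c' by simp
    then obtain N where N: "\<And>n. n \<ge> N \<Longrightarrow> dist x (a n) < d + min \<delta> c'"
      unfolding eventually_sequentially by blast
    have "dist (a m) (a n) < e" if "m \<ge> N" "n \<ge> N" for m n
    proof -
      define u v where "u = a m - x" and "v = a n - x"
      have u: "norm u \<le> d + c'" "D u \<le> - d + c'" and v: "norm v \<le> d + c'" "D v \<le> - d + c'"
        using N[of m] N[of n] that \<delta>(2)[OF a(1)[of m]] \<delta>(2)[OF a(1)[of n]]
        by (auto simp: u_def v_def dist_norm norm_minus_commute)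
      have "2 * d - 2 * c' \<le> norm (u + v)"
        using infdist_derivative_le[OF D, of "u + v"] u(2) v(2) by (simp add: D.add)
      \<comment> \<open>Squaring needs a nonnegative left side; otherwise \<open>d < c'\<close>, and
        the lower bound claimed in \<open>s\<close> is nonpositive.\<close>
      then have "(2 * d - 2 * c')\<^sup>2 \<le> (norm (u + v))\<^sup>2 \<or> 2 * d - 2 * c' < 0"
        by (meson not_le power_mono)
      then have s: "4 * d\<^sup>2 - 8 * d * c' - 4 * c'\<^sup>2 \<le> (norm (u + v))\<^sup>2"
      proof
        assume "(2 * d - 2 * c')\<^sup>2 \<le> (norm (u + v))\<^sup>2"
        moreover have "(2 * d - 2 * c')\<^sup>2 = 4 * d\<^sup>2 - 8 * d * c' + 4 * c'\<^sup>2" by (simp add: power2_eq_square algebra_simps)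
        ultimately show ?thesis using zero_le_power2[of c'] by linarith
      next
        assume "2 * d - 2 * c' < 0"
        then have "d * d \<le> d * c'" using d0 by (intro mult_left_mono) auto
        moreover have "d * c' \<ge> 0" using d0 c' by simp
        ultimately show ?thesis using zero_le_power2[of "norm (u+v)"] zero_le_power2[of c']
          unfolding power2_eq_square by linarith
      qed
      have q: "(norm u)\<^sup>2 \<le> (d + c')\<^sup>2" "(norm v)\<^sup>2 \<le> (d + c')\<^sup>2" using u v by (auto intro: power_mono)
      have "(norm (u - v))\<^sup>2 = 2 * (norm u)\<^sup>2 + 2 * (norm v)\<^sup>2 - (norm (u + v))\<^sup>2"
        by (simp add: power2_norm_eq_inner inner_simps inner_commute)
      also have "\<dots> \<le> 4 * (d + c')\<^sup>2 - (4 * d\<^sup>2 - 8 * d * c' - 4 * c'\<^sup>2)" using q s by linarith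
      also have "\<dots> = c' * (16 * d + 8 * c')" by (simp add: power2_eq_square algebra_simps)
      also have "\<dots> < c' * (16 * (d + 1) + 4)" using c' by (intro mult_strict_left_mono) auto
      also have "\<dots> \<le> c * (16 * (d + 1) + 4)" using c' d0 by (intro mult_right_mono) auto
      also have "\<dots> = e\<^sup>2" using d0 by (simp add: c_def)
      finally have "norm (u - v) < e" using e by (simp add: power2_less_imp_less)
      then show ?thesis by (simp add: u_def v_def dist_norm)
    qed
    then show "\<exists>N. \<forall>m\<ge>N. \<forall>n\<ge>N. dist (a m) (a n) < e" by blast
  qed
  then obtain p where p: "a \<longlonglongrightarrow> p" using Cauchy_convergent convergent_def by blast
  have "p \<in> A" using closed_sequentially[OF A(1)] a(1) p by blast
  moreover have "dist x p = d"
    using LIMSEQ_unique[OF tendsto_dist[OF tendsto_const p] ad] by simp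
  ultimately show thesis using that by (simp add: nearest_point_def d_def)
qed

section \<open>Ekeland's principle and growth of the distance along normal rays\<close>

text \<open>\<open>T y\<close> collects the points above \<open>y\<close> in the order "gain at
  least \<open>k\<close> per unit of distance". Each step of the sequence realizes at least half of
  the gain still available; as the total gain is bounded, the sequence is Cauchy, and nothing lies
  strictly above its limit.\<close>

lemma ekeland_maximal_point:
  fixes g :: "'a::metric_space \<Rightarrow> real"
  assumes S: "complete S" "x \<in> S" and g: "continuous_on S g" "\<And>y. y \<in> S \<Longrightarrow> g y \<le> M" and k: "k > 0"
  obtains y where "y \<in> S" "k * dist x y \<le> g y - g x"
    "\<And>z. z \<in> S \<Longrightarrow> k * dist y z \<le> g z - g y \<Longrightarrow> z = y"
proof -
  define T where "T y = {z \<in> S. k * dist y z \<le> g z - g y}" for y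
  have T_trans: "z \<in> T w" if "y \<in> T w" "z \<in> T y" for w y z
  proof -
    have "k * dist w z \<le> k * (dist w y + dist y z)" using k by (simp add: dist_triangle)
    then show ?thesis using that by (auto simp: T_def algebra_simps)
  qed
  have T_refl: "y \<in> T y" if "y \<in> S" for y using that by (simp add: T_def)
  have bdd: "bdd_above (g ` T y)" for y by (rule bdd_aboveI[of _ M]) (auto simp: T_def g)
  have step: "\<exists>z. z \<in> T y \<and> (g y + Sup (g ` T y)) / 2 \<le> g z" if y: "y \<in> S" for y
  proof (cases "g y < Sup (g ` T y)")
    case True
    then have "(g y + Sup (g ` T y)) / 2 < Sup (g ` T y)" by simp
    then obtain z where "z \<in> T y" "(g y + Sup (g ` T y)) / 2 < g z"
      using less_cSUP_iff[OF _ bdd] T_refl[OF y] by blast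
    then show ?thesis by (auto intro: less_imp_le)
  next
    case False
    then show ?thesis using T_refl[OF y] by (intro exI[of _ y]) auto
  qed
  obtain s where s0: "s 0 = x" and sS: "\<And>n. s n \<in> S"
    and sT: "\<And>n. s (Suc n) \<in> T (s n) \<and> (g (s n) + Sup (g ` T (s n))) / 2 \<le> g (s (Suc n))"
  proof -
    have "\<exists>s. \<forall>n. (s n \<in> S \<and> (n = 0 \<longrightarrow> s n = x)) \<and>
        (s (Suc n) \<in> T (s n) \<and> (g (s n) + Sup (g ` T (s n))) / 2 \<le> g (s (Suc n)))"
      by (rule dependent_nat_choice) (use S step T_def in auto)
    then show thesis using that by metis
  qed
  have sT': "s n \<in> T (s m)" if "m \<le> n" for m n
    using that
  proof (induction rule: dec_induct)
    case base then show ?case by (simp add: T_refl sS)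
  next
    case (step n) then show ?case using T_trans sT by blast
  qed
  have inc: "incseq (\<lambda>n. g (s n))"
  proof (rule incseq_SucI)
    fix n show "g (s n) \<le> g (s (Suc n))"
    proof -
      have "0 \<le> k * dist (s n) (s (Suc n))" using k by simp
      also have "\<dots> \<le> g (s (Suc n)) - g (s n)" using sT[of n] by (simp add: T_def)
      finally show ?thesis by simp
    qed
  qed
  then obtain L where L: "(\<lambda>n. g (s n)) \<longlonglongrightarrow> L"
    using incseq_convergent[of "\<lambda>n. g (s n)" M] g(2) sS by metis
  have "Cauchy s"
  proof (rule metric_CauchyI)
    fix e :: real assume e: "e > 0"
    obtain N where N: "\<And>m n. m \<ge> N \<Longrightarrow> n \<ge> N \<Longrightarrow> dist (g (s m)) (g (s n)) < k * e"
      using metric_CauchyD[OF LIMSEQ_imp_Cauchy[OF L], of "k * e"] e k by auto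
    have "dist (s m) (s n) < e" if "m \<ge> N" "n \<ge> m" for m n
    proof -
      have "k * dist (s m) (s n) \<le> g (s n) - g (s m)" using sT'[OF that(2)] by (simp add: T_def)
      also have "\<dots> < k * e" using N[of m n] that by (simp add: dist_real_def)
      finally show ?thesis using k by simp
    qed
    then have "\<forall>m\<ge>N. \<forall>n\<ge>N. dist (s m) (s n) < e" by (metis dist_commute linear)
    then show "\<exists>N. \<forall>m\<ge>N. \<forall>n\<ge>N. dist (s m) (s n) < e" by blast
  qed
  then obtain y where y: "y \<in> S" "s \<longlonglongrightarrow> y" using S(1) sS unfolding complete_def by blast
  have gy: "(\<lambda>n. g (s n)) \<longlonglongrightarrow> g y"
    using continuous_on_tendsto_compose[OF g(1) y(2,1)] sS by simp
  have yT: "y \<in> T (s m)" for m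
  proof -
    have "k * dist (s m) y \<le> g y - g (s m)"
    proof (rule tendsto_le)
      show "(\<lambda>n. k * dist (s m) (s n)) \<longlonglongrightarrow> k * dist (s m) y" by (intro tendsto_intros y)
      show "(\<lambda>n. g (s n) - g (s m)) \<longlonglongrightarrow> g y - g (s m)" by (intro tendsto_intros gy)
      show "\<forall>\<^sub>F n in sequentially. k * dist (s m) (s n) \<le> g (s n) - g (s m)"
        using sT' unfolding eventually_sequentially T_def by blast
    qed simp
    then show ?thesis using y by (simp add: T_def)
  qed
  show thesis
  proof (rule that[OF y(1)])
    show "k * dist x y \<le> g y - g x" using yT[of 0] s0 by (simp add: T_def)
    fix z assume z: "z \<in> S" "k * dist y z \<le> g z - g y"
    then have "z \<in> T y" by (simp add: T_def)
    \<comment> \<open>A point above \<open>y\<close> is above every \<open>s n\<close>; the halving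
      rule, solved for the supremum, gives this bound, which tends to \<open>g y\<close>.\<close>
    have "g z \<le> 2 * g (s (Suc n)) - g (s n)" for n
    proof -
      have "g z \<le> Sup (g ` T (s n))" using T_trans[OF yT \<open>z \<in> T y\<close>] bdd by (auto intro: cSUP_upper)
      then show ?thesis using sT[of n] by simp
    qed
    moreover have "(\<lambda>n. 2 * g (s (Suc n)) - g (s n)) \<longlonglongrightarrow> 2 * g y - g y"
      by (intro tendsto_intros gy LIMSEQ_Suc)
    ultimately have "g z \<le> 2 * g y - g y" by (intro LIMSEQ_le_const) auto
    then have "k * dist y z \<le> 0" using z by simp
    then show "z = y" using k by (simp add: mult_le_0_iff)
  qed
qed

lemma proximally_smooth_derivative:
  assumes "proximally_smooth R A" "0 < infdist x A" "infdist x A < R"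
  obtains D where "((\<lambda>y. infdist y A) has_derivative D) (at x)"
  using assms unfolding proximally_smooth_def by blast

lemma proximally_smooth_nearest_point:
  assumes A: "proximally_smooth R A" "A \<noteq> {}" and x: "infdist x A < R"
  obtains p where "nearest_point A x p"
proof (cases "infdist x A = 0")
  case True
  then have "x \<in> A" using A in_closed_iff_infdist_zero proximally_smooth_def by blast
  then show thesis using that[of x] True by (simp add: nearest_point_def)
next
  case False
  then have "0 < infdist x A" using infdist_nonneg[of x A] by linarith
  then show thesis
    using proximally_smooth_derivative[OF A(1) _ x] nearest_point_exists A that proximally_smooth_def by metis
qed

lemma power2_norm_scaleR_diff:
  fixes a b :: "'a::real_inner"
  shows "(norm (k *\<^sub>R a - b))\<^sup>2 = k\<^sup>2 * (norm a)\<^sup>2 - 2 * k * (a \<bullet> b) + (norm b)\<^sup>2"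
  unfolding power2_norm_eq_inner by (simp add: inner_simps inner_commute power2_eq_square)

text \<open>In infinite dimension the supremum of the distance over a ball need not be attained, so
  Ekeland's principle with slope \<open>k < 1\<close> replaces a maximum. The bound
  \<open>infdist x A + r < R\<close> keeps the distance below \<open>R\<close> on the whole
  ball.\<close>

lemma infdist_almost_slope_one:
  fixes A :: "'a::{real_inner,complete_space} set"
  assumes A: "proximally_smooth R A" "A \<noteq> {}"
    and x: "0 < infdist x A" "infdist x A + r < R" "r \<ge> 0" and k: "0 < k" "k < 1"
  obtains y where "dist x y \<le> r" "infdist x A + k * r \<le> infdist y A"
proof -
  have bd: "infdist y A \<le> infdist x A + r" if "y \<in> cball x r" for y
    using infdist_triangle[of y A x] that by (simp add: dist_commute)
  obtain y where y: "y \<in> cball x r" "k * dist x y \<le> infdist y A - infdist x A"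
    and y_max: "\<And>z. z \<in> cball x r \<Longrightarrow> k * dist y z \<le> infdist z A - infdist y A \<Longrightarrow> z = y"
    by (rule ekeland_maximal_point[of "cball x r" x "\<lambda>y. infdist y A" "infdist x A + r" k])
      (use x k bd in \<open>auto intro!: continuous_intros simp: complete_eq_closed\<close>)
  have "0 \<le> k * dist x y" using k by simp
  then have d: "0 < infdist y A" "infdist y A < R" using y(2) x(1,2) bd[OF y(1)] by linarith+
  \<comment> \<open>A maximal point inside the ball could be improved by moving away from its nearest point,
    since the distance grows there with slope one; so the maximal point is on the sphere.\<close>
  have "dist x y = r"
  proof (rule ccontr)
    assume "dist x y \<noteq> r"
    then have lt: "dist x y < r" using y by simp
    obtain D where D: "((\<lambda>y. infdist y A) has_derivative D) (at y)"
      using proximally_smooth_derivative[OF A(1) d] .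
    interpret D: bounded_linear D using D by (rule has_derivative_bounded_linear)
    obtain q where q: "nearest_point A y q" using proximally_smooth_nearest_point[OF A d(2)] .
    define w where "w = y - q"
    have w: "D w = norm w" "norm w > 0"
      using nearest_point_derivative[OF D q] q d by (auto simp: w_def nearest_point_def dist_norm)
    obtain h where h: "h > 0"
      "\<And>z. norm (z - y) < h \<Longrightarrow> \<bar>infdist z A - infdist y A - D (z - y)\<bar> \<le> (1 - k) * norm (z - y)"
      using D k unfolding has_derivative_at_alt by (metis real_norm_def diff_gt_0_iff_gt)
    \<comment> \<open>The factor 2 leaves room to stay strictly within the range \<open>h\<close> of
      the linearization and strictly inside the ball.\<close>
    define t where "t = min h (r - dist x y) / (2 * norm w)"
    have t: "t > 0" "t * norm w < h" "t * norm w < r - dist x y"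
      using h(1) lt w by (auto simp: t_def field_simps min_def)
    have "\<bar>infdist (y + t *\<^sub>R w) A - infdist y A - t * norm w\<bar> \<le> (1 - k) * (t * norm w)"
      using h(2)[of "y + t *\<^sub>R w"] t by (simp add: D.scaleR w)
    then have "k * (t * norm w) \<le> infdist (y + t *\<^sub>R w) A - infdist y A"
      by (simp add: abs_le_iff algebra_simps)
    moreover have "dist y (y + t *\<^sub>R w) = t * norm w" using t by (simp add: dist_norm)
    moreover have "y + t *\<^sub>R w \<in> cball x r"
      using dist_triangle[of x "y + t *\<^sub>R w" y] t calculation by simp
    ultimately have "y + t *\<^sub>R w = y" using y_max by presburger
    then show False using t w by simp
  qed
  then show thesis using that[of y] y by simp
qed

text \<open>The opposite inequality comes from \<open>p\<close>, whose distance from the point on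
  the ray is \<open>infdist x A + r\<close>; so the distance grows with slope exactly one along the
  normal ray as long as it stays below \<open>R\<close>.\<close>

lemma infdist_along_ray:
  fixes A :: "'a::{real_inner,complete_space} set"
  assumes A: "proximally_smooth R A"
    and x: "0 < infdist x A" "infdist x A + r < R" "r \<ge> 0" and p: "nearest_point A x p"
  shows "infdist x A + r \<le> infdist (x + (r / infdist x A) *\<^sub>R (x - p)) A"
proof -
  define d where "d = infdist x A"
  define w where "w = x - p"
  define c where "c = x + (r / d) *\<^sub>R w"
  have d: "d > 0" using x by (simp add: d_def)
  have w: "norm w = d" using p by (simp add: w_def d_def nearest_point_def dist_norm)
  have pA: "p \<in> A" using p by (simp add: nearest_point_def)
  \<comment> \<open>By uniform convexity, a point within \<open>r\<close> of \<open>x\<close> whose distance to \<open>p\<close> is almost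
    \<open>d + r\<close> is close to \<open>c\<close>; the error bound vanishes as \<open>k\<close> tends to 1.\<close>
  have key: "d + k * r - sqrt (2 * r\<^sup>2 - 2 * k * r\<^sup>2 + (1 - k\<^sup>2) * r^3 / d) \<le> infdist c A"
    if k: "0 < k" "k < 1" for k
  proof -
    obtain y where y: "dist x y \<le> r" "d + k * r \<le> infdist y A"
      using infdist_almost_slope_one[OF A _ x k] pA unfolding d_def by blast
    define e where "e = y - x"
    have e: "norm e \<le> r" using y by (simp add: e_def dist_norm norm_minus_commute)
    have "d + k * r \<le> norm (e + w)"
      using y(2) infdist_le[OF pA, of y] by (simp add: e_def w_def dist_norm)
    then have "(d + k * r)\<^sup>2 \<le> (norm (e + w))\<^sup>2" using d k x by (intro power_mono) auto
    also have "\<dots> = (norm e)\<^sup>2 + 2 * (e \<bullet> w) + d\<^sup>2"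
      unfolding w[symmetric] by (simp add: power2_norm_eq_inner inner_simps inner_commute)
    finally have 1: "2 * d * k * r + k\<^sup>2 * r\<^sup>2 \<le> (norm e)\<^sup>2 + 2 * (e \<bullet> w)"
      by (simp add: power2_eq_square algebra_simps)
    have e2: "(norm e)\<^sup>2 \<le> r\<^sup>2" using e by (intro power_mono) auto
    have ew: "2 * d * k * r - (1 - k\<^sup>2) * r\<^sup>2 \<le> 2 * (e \<bullet> w)" using 1 e2 by (simp add: algebra_simps)
    have "(dist y c)\<^sup>2 = (norm (e - (r / d) *\<^sub>R w))\<^sup>2" by (simp add: dist_norm e_def c_def algebra_simps)
    also have "\<dots> = (norm e)\<^sup>2 - (r / d) * (2 * (e \<bullet> w)) + (r / d)\<^sup>2 * (norm w)\<^sup>2"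
      unfolding power2_norm_eq_inner by (simp add: inner_simps inner_commute power2_eq_square algebra_simps)
    also have "\<dots> \<le> r\<^sup>2 - (r / d) * (2 * d * k * r - (1 - k\<^sup>2) * r\<^sup>2) + (r / d)\<^sup>2 * (norm w)\<^sup>2"
    proof -
      have "(r / d) * (2 * d * k * r - (1 - k\<^sup>2) * r\<^sup>2) \<le> (r / d) * (2 * (e \<bullet> w))"
        using ew d x by (intro mult_left_mono) auto
      then show ?thesis using e2 by linarith
    qed
    also have "\<dots> = 2 * r\<^sup>2 - 2 * k * r\<^sup>2 + (1 - k\<^sup>2) * r^3 / d"
      using d by (simp add: w power2_eq_square power3_eq_cube field_simps)
    finally have "dist y c \<le> sqrt (2 * r\<^sup>2 - 2 * k * r\<^sup>2 + (1 - k\<^sup>2) * r^3 / d)"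
      by (rule real_le_rsqrt)
    then show ?thesis using infdist_triangle[of y A c] y(2) by linarith
  qed
  have "((\<lambda>k. d + k * r - sqrt (2 * r\<^sup>2 - 2 * k * r\<^sup>2 + (1 - k\<^sup>2) * r^3 / d))
      \<longlongrightarrow> d + 1 * r - sqrt (2 * r\<^sup>2 - 2 * 1 * r\<^sup>2 + (1 - 1\<^sup>2) * r^3 / d)) (at_left 1)"
    using d by (intro tendsto_intros) auto
  moreover have "\<forall>\<^sub>F k in at_left 1. d + k * r - sqrt (2 * r\<^sup>2 - 2 * k * r\<^sup>2 + (1 - k\<^sup>2) * r^3 / d) \<le> infdist c A"
    using key unfolding eventually_at_left[OF zero_less_one] by (intro exI[of _ 0]) auto
  ultimately have "d + 1 * r - sqrt (2 * r\<^sup>2 - 2 * 1 * r\<^sup>2 + (1 - 1\<^sup>2) * r^3 / d) \<le> infdist c A"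
    by (intro tendsto_upperbound) auto
  then show ?thesis by (simp add: c_def d_def w_def)
qed

section \<open>Proximal normal inequality and Lipschitz dependence of nearest points\<close>

text \<open>By \<open>infdist_along_ray\<close>, the open ball of radius \<open>t\<close> that
  touches \<open>A\<close> at \<open>p\<close> along the normal misses \<open>A\<close>. Expanding
  \<open>t \<le> norm (c - a)\<close> gives the inequality with \<open>t\<close> in place of
  \<open>R\<close>; the ray lemma reaches only \<open>t < R\<close>, so a limit finishes.\<close>

lemma proximal_normal_inequality:
  fixes A :: "'a::{real_inner,complete_space} set"
  assumes A: "proximally_smooth R A" and x: "infdist x A < R" and p: "nearest_point A x p" and a: "a \<in> A"
  shows "2 * R * ((x - p) \<bullet> (a - p)) \<le> infdist x A * (dist a p)\<^sup>2"
proof (cases "infdist x A = 0")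
  case True
  then show ?thesis using p by (simp add: nearest_point_def)
next
  case False
  define d where "d = infdist x A"
  have d: "0 < d" using False infdist_nonneg[of x A] by (simp add: d_def)
  have w: "norm (x - p) = d" using p by (simp add: d_def nearest_point_def dist_norm)
  have key: "2 * t * ((x - p) \<bullet> (a - p)) \<le> d * (dist a p)\<^sup>2" if t: "d < t" "t < R" for t
  proof -
    \<comment> \<open>Equivalently \<open>c = p + (t / d) *\<^sub>R (x - p)\<close>, the point at
      distance \<open>t\<close> from \<open>p\<close> on the normal ray.\<close>
    define c where "c = x + ((t - d) / d) *\<^sub>R (x - p)"
    have c: "c - a = (t / d) *\<^sub>R (x - p) - (a - p)" using d by (simp add: c_def algebra_simps diff_divide_distrib)
    have "t \<le> norm (c - a)"
      using infdist_along_ray[OF A _ _ _ p, of "t - d"] infdist_le[OF a, of c] t d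
      by (simp add: c_def d_def dist_norm)
    then have "t\<^sup>2 \<le> (norm (c - a))\<^sup>2" using t d by (intro power_mono) auto
    also have "\<dots> = (t / d)\<^sup>2 * (norm (x - p))\<^sup>2 - 2 * (t / d) * ((x - p) \<bullet> (a - p)) + (norm (a - p))\<^sup>2"
      unfolding c by (rule power2_norm_scaleR_diff)
    also have "\<dots> = t\<^sup>2 - 2 * (t / d) * ((x - p) \<bullet> (a - p)) + (dist a p)\<^sup>2"
      using d by (simp add: w dist_norm power2_eq_square)
    finally show ?thesis using d by (simp add: field_simps)
  qed
  have "((\<lambda>t. 2 * t * ((x - p) \<bullet> (a - p))) \<longlongrightarrow> 2 * R * ((x - p) \<bullet> (a - p))) (at_left R)"
    by (intro tendsto_intros)
  moreover have "\<forall>\<^sub>F t in at_left R. 2 * t * ((x - p) \<bullet> (a - p)) \<le> d * (dist a p)\<^sup>2"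
    using key x unfolding eventually_at_left[OF x] d_def by blast
  ultimately show ?thesis unfolding d_def by (intro tendsto_upperbound) auto
qed

text \<open>Testing the normal inequality at \<open>p\<close> with \<open>q\<close> and at
  \<open>q\<close> with \<open>p\<close>, and adding, shows that the normals are monotone up to
  \<open>r / R\<close> times the square of \<open>dist p q\<close>. By Cauchy-Schwarz the projection
  has Lipschitz constant \<open>R / (R - r)\<close>.\<close>

lemma nearest_point_lipschitz:
  fixes A :: "'a::{real_inner,complete_space} set"
  assumes A: "proximally_smooth R A" and x: "infdist x A \<le> r" and y: "infdist y A \<le> r" and r: "r < R"
    and p: "nearest_point A x p" and q: "nearest_point A y q"
  shows "(R - r) * dist p q \<le> R * dist x y"
proof (cases "p = q")
  case True
  then show ?thesis using x r infdist_nonneg[of x A] by simp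
next
  case False
  have R: "R > 0" using x r infdist_nonneg[of x A] by linarith
  have 1: "2 * R * ((x - p) \<bullet> (q - p)) \<le> r * (dist p q)\<^sup>2"
    by (rule order_trans[OF proximal_normal_inequality[OF A _ p, of q]])
      (use q x r in \<open>auto simp: nearest_point_def dist_commute intro: mult_right_mono\<close>)
  have 2: "2 * R * ((y - q) \<bullet> (p - q)) \<le> r * (dist p q)\<^sup>2"
    by (rule order_trans[OF proximal_normal_inequality[OF A _ q, of p]])
      (use p y r in \<open>auto simp: nearest_point_def intro: mult_right_mono\<close>)
  have "(x - p) \<bullet> (q - p) + (y - q) \<bullet> (p - q) = (dist p q)\<^sup>2 - (x - y) \<bullet> (p - q)"
  proof -
    have "(x - p) \<bullet> (q - p) + (y - q) \<bullet> (p - q) = ((q - p) - (y - x)) \<bullet> (q - p)"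
      using inner_minus_right[of "y - q" "q - p"] by (simp add: inner_diff_left)
    also have "\<dots> = (dist p q)\<^sup>2 + (y - x) \<bullet> (p - q)"
      using inner_minus_right[of "y - x" "q - p"]
      by (simp add: inner_diff_left[of "q - p"] dist_commute[of p q] dist_norm[of q p] power2_norm_eq_inner)
    also have "(y - x) \<bullet> (p - q) = - ((x - y) \<bullet> (p - q))" by (simp flip: inner_minus_left)
    finally show ?thesis by simp
  qed
  then have "2 * R * ((dist p q)\<^sup>2 - (x - y) \<bullet> (p - q))
      = 2 * R * ((x - p) \<bullet> (q - p)) + 2 * R * ((y - q) \<bullet> (p - q))"
    by (metis distrib_left)
  then have "2 * R * ((dist p q)\<^sup>2 - (x - y) \<bullet> (p - q)) \<le> 2 * (r * (dist p q)\<^sup>2)"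
    using 1 2 by linarith
  then have "(R - r) * (dist p q)\<^sup>2 \<le> R * ((x - y) \<bullet> (p - q))"
    by (simp only: right_diff_distrib left_diff_distrib)
  also have "\<dots> \<le> R * (dist x y * dist p q)"
    using norm_cauchy_schwarz R by (simp add: dist_norm)
  finally have "((R - r) * dist p q) * dist p q \<le> (R * dist x y) * dist p q"
    by (simp add: power2_eq_square mult.assoc)
  then show ?thesis using False by simp
qed

section \<open>Slice-projections of midpoints\<close>

lemma endpoints_via_midpoint:
  fixes u v :: "'a::real_vector"
  shows "u = midpoint u v - (1 / 2) *\<^sub>R (v - u)" "v = midpoint u v + (1 / 2) *\<^sub>R (v - u)"
proof -
  have "(1 / 2) *\<^sub>R x + (1 / 2) *\<^sub>R x = x" for x :: 'a by (simp flip: scaleR_left_distrib)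
  from this[of u] this[of v]
  show "u = midpoint u v - (1 / 2) *\<^sub>R (v - u)" "v = midpoint u v + (1 / 2) *\<^sub>R (v - u)"
    unfolding midpoint_def by (auto simp: scaleR_right_distrib scaleR_right_diff_distrib)
qed

text \<open>Each point of the segment is within \<open>dist u v / 2\<close> of an endpoint, so one
  radius \<open>r < R\<close> serves \<open>nearest_point_lipschitz\<close> on the whole segment.
  The endpoints project to themselves, with opposite signs of the function whose zero is
  sought.\<close>

lemma nearest_point_in_hyperplane:
  fixes A :: "'a::{real_inner,complete_space} set"
  assumes A: "proximally_smooth R A" and uv: "u \<in> A" "v \<in> A" "dist u v < 2 * R"
  obtains s p where "0 \<le> s" "s \<le> 1" "infdist (u + s *\<^sub>R (v - u)) A < R"
    "nearest_point A (u + s *\<^sub>R (v - u)) p" "p \<in> slice_hyperplane u v (midpoint u v)"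
proof -
  define r where "r = dist u v / 2"
  have rR: "r < R" using uv by (simp add: r_def)
  define z where "z s = u + s *\<^sub>R (v - u)" for s :: real
  have z: "infdist (z s) A \<le> r" if "s \<in> {0..1}" for s
  proof (cases "s \<le> 1 / 2")
    case True
    have "infdist (z s) A \<le> dist (z s) u" using uv by (intro infdist_le)
    also have "\<dots> = s * dist u v" using that by (simp add: z_def dist_norm norm_minus_commute)
    also have "\<dots> \<le> 1 / 2 * dist u v" using True by (intro mult_right_mono) auto
    finally show ?thesis by (simp add: r_def)
  next
    case False
    have "z s - v = (1 - s) *\<^sub>R (u - v)" by (simp add: z_def algebra_simps)
    have "infdist (z s) A \<le> dist (z s) v" using uv by (intro infdist_le)
    also have "\<dots> = (1 - s) * dist u v" using that \<open>z s - v = _\<close> by (simp add: dist_norm)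
    also have "\<dots> \<le> 1 / 2 * dist u v" using False by (intro mult_right_mono) auto
    finally show ?thesis by (simp add: r_def)
  qed
  have "\<exists>p. nearest_point A (z s) p" if "s \<in> {0..1}" for s
    using proximally_smooth_nearest_point[OF A _ le_less_trans[OF z[OF that] rR]] uv by blast
  then obtain P where P: "\<And>s. s \<in> {0..1} \<Longrightarrow> nearest_point A (z s) (P s)" by metis
  have R: "R > 0" using uv zero_le_dist[of u v] by linarith
  have "(R / (R - r) * dist u v)-lipschitz_on {0..1} P"
  proof (rule lipschitz_onI)
    fix s t :: real assume st: "s \<in> {0..1}" "t \<in> {0..1}"
    have "z s - z t = (s - t) *\<^sub>R (v - u)" by (simp add: z_def algebra_simps)
    then have "dist (z s) (z t) = dist s t * dist u v"
      unfolding dist_commute[of u] by (simp add: dist_norm)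
    then have "(R - r) * dist (P s) (P t) \<le> R * (dist s t * dist u v)"
      using nearest_point_lipschitz[OF A z[OF st(1)] z[OF st(2)] rR P[OF st(1)] P[OF st(2)]] by simp
    then have "dist (P s) (P t) \<le> R * (dist s t * dist u v) / (R - r)"
      using rR by (simp add: pos_le_divide_eq mult.commute)
    then show "dist (P s) (P t) \<le> R / (R - r) * dist u v * dist s t"
      by (simp add: ac_simps)
  qed (use R rR in simp)
  then have "continuous_on {0..1} P" by (rule lipschitz_on_continuous_on)
  then have cont: "continuous_on {0..1} (\<lambda>s. (P s - midpoint u v) \<bullet> (v - u))"
    by (intro continuous_intros)
  have move: "a = b - c \<Longrightarrow> a - b = - c" "a = b + c \<Longrightarrow> a - b = c" for a b c :: 'a
    by simp_all
  have "P 0 = u" "P 1 = v"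
    using P[of 0] P[of 1] uv by (auto simp: nearest_point_def z_def)
  moreover have "u - midpoint u v = - ((1 / 2) *\<^sub>R (v - u))" "v - midpoint u v = (1 / 2) *\<^sub>R (v - u)"
    by (rule move(1)[OF endpoints_via_midpoint(1)], rule move(2)[OF endpoints_via_midpoint(2)])
  ultimately have "(P 0 - midpoint u v) \<bullet> (v - u) \<le> 0" "0 \<le> (P 1 - midpoint u v) \<bullet> (v - u)"
    by (simp_all only: inner_minus_left inner_scaleR_left) simp_all
  then obtain s where "0 \<le> s" "s \<le> 1" "(P s - midpoint u v) \<bullet> (v - u) = 0"
    using IVT'[of "\<lambda>s. (P s - midpoint u v) \<bullet> (v - u)" 0 0 1] cont by auto
  then show thesis
    using that[of s "P s"] P[of s] z[of s] rR by (simp add: slice_hyperplane_def z_def)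
qed

text \<open>\<open>z - m\<close> is normal to the hyperplane, so against vectors
  \<open>q - p\<close> of the hyperplane the inequality at \<open>z\<close> holds with
  \<open>m - p\<close> in place of \<open>z - p\<close>; hence \<open>p\<close> is also nearest to
  \<open>m\<close> there. The quadratic inequality, together with height \<open>< R\<close>, places
  the height at or below the sagitta.\<close>

lemma slice_projection_midpoint:
  fixes A :: "'a::{real_inner,complete_space} set"
  assumes A: "proximally_smooth R A" and uv: "u \<in> A" "v \<in> A" "dist u v < 2 * R"
  obtains p where "slice_projection A u v (midpoint u v) p"
    "\<And>q. slice_projection A u v (midpoint u v) q \<Longrightarrow> q = p"
    "p \<in> A" "dist (midpoint u v) p < R"
    "2 * R * dist (midpoint u v) p \<le> (dist (midpoint u v) p)\<^sup>2 + (dist u v / 2)\<^sup>2"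
    "(dist u p)\<^sup>2 = (dist (midpoint u v) p)\<^sup>2 + (dist u v / 2)\<^sup>2"
    "(dist p v)\<^sup>2 = (dist (midpoint u v) p)\<^sup>2 + (dist u v / 2)\<^sup>2"
proof -
  obtain s p where s: "0 \<le> s" "s \<le> 1" "infdist (u + s *\<^sub>R (v - u)) A < R"
    and p: "nearest_point A (u + s *\<^sub>R (v - u)) p" and H: "p \<in> slice_hyperplane u v (midpoint u v)"
    using nearest_point_in_hyperplane[OF A uv] by blast
  define m where "m = midpoint u v"
  define w where "w = (1 / 2) *\<^sub>R (v - u)"
  define z where "z = u + s *\<^sub>R (v - u)"
  define d where "d = infdist z A"
  have R: "R > 0" using uv zero_le_dist[of u v] by linarith
  have u: "u = m - w" and v: "v = m + w"
    unfolding m_def w_def by (fact endpoints_via_midpoint)+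
  have zm: "z = m + (2 * s - 1) *\<^sub>R w"
  proof -
    have "v - u = 2 *\<^sub>R w" by (simp add: w_def)
    then have "z = m - w + (2 * s) *\<^sub>R w" unfolding z_def by (simp add: u)
    then show ?thesis by (simp add: scaleR_left_diff_distrib)
  qed
  have nw: "norm w = dist u v / 2" by (simp add: w_def dist_norm norm_minus_commute)
  have pA: "p \<in> A" and zp: "norm (z - p) = d"
    using p by (auto simp: nearest_point_def z_def d_def dist_norm)
  have d: "0 \<le> d" "d < R" using s by (auto simp: d_def z_def infdist_nonneg)
  have orth: "(q - m) \<bullet> w = 0" if "q \<in> slice_hyperplane u v m" for q
    using that by (simp add: slice_hyperplane_def w_def)
  have pw: "(p - m) \<bullet> w = 0" using H orth by (simp add: m_def)
  have pw': "(m - p) \<bullet> w = 0" using pw inner_minus_left[of "p - m" w] by simp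
  have up: "(dist u p)\<^sup>2 = (dist m p)\<^sup>2 + (dist u v / 2)\<^sup>2"
    using norm_add_Pythagorean[of "m - p" "- w"] pw' unfolding nw[symmetric] unfolding dist_norm
    by (simp add: orthogonal_def u diff_diff_eq add.commute)
  have vp: "(dist p v)\<^sup>2 = (dist m p)\<^sup>2 + (dist u v / 2)\<^sup>2"
  proof -
    have "v - p = (m - p) + w" by (simp add: v)
    then show ?thesis
      using norm_add_Pythagorean[of "m - p" w] pw' unfolding nw[symmetric] dist_commute[of p v]
      by (simp only: orthogonal_def dist_norm)
  qed
  have prox: "2 * R * ((z - p) \<bullet> (a - p)) \<le> d * (dist a p)\<^sup>2" if "a \<in> A" for a
    using proximal_normal_inequality[OF A s(3) p that] by (simp add: z_def d_def)
  \<comment> \<open>Pythagoras: \<open>m\<close> is the foot of \<open>z\<close> on the hyperplane,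
    which contains \<open>p\<close>.\<close>
  have "d\<^sup>2 = (dist m p)\<^sup>2 + (2 * s - 1)\<^sup>2 * (norm w)\<^sup>2"
  proof -
    have "z - p = (m - p) + (2 * s - 1) *\<^sub>R w" by (simp add: zm)
    moreover have "orthogonal (m - p) ((2 * s - 1) *\<^sub>R w)" using pw' by (simp add: orthogonal_def)
    ultimately show ?thesis unfolding zp[symmetric] using norm_add_Pythagorean[of "m - p" "(2 * s - 1) *\<^sub>R w"]
      by (simp only: dist_norm norm_scaleR power_mult_distrib power2_abs)
  qed
  then have "(dist m p)\<^sup>2 \<le> d\<^sup>2" by (simp only: le_add_same_cancel1 zero_le_mult_iff zero_le_power2 simp_thms)
  then have hd: "dist m p \<le> d" using d(1) by (rule power2_le_imp_le)
  have h: "2 * R * dist m p \<le> (dist m p)\<^sup>2 + (dist u v / 2)\<^sup>2"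
  proof (cases "d = 0")
    case True
    then show ?thesis using hd by (simp add: dist_le_zero_iff)
  next
    case False
    let ?K = "(dist m p)\<^sup>2 + (dist u v / 2)\<^sup>2"
    have "2 * R * ((z - p) \<bullet> (u - p)) \<le> d * ?K" "2 * R * ((z - p) \<bullet> (v - p)) \<le> d * ?K"
      using prox[OF uv(1)] prox[OF uv(2)] unfolding dist_commute[of v p] up vp .
    \<comment> \<open>The weights are those of \<open>z\<close> on the segment: the same combination
      of \<open>u - p\<close> and \<open>v - p\<close> is \<open>z - p\<close>, so the left side
      becomes \<open>2 * R * d * d\<close> and one factor \<open>d\<close> cancels.\<close>
    then have "(1 - s) * (2 * R * ((z - p) \<bullet> (u - p))) + s * (2 * R * ((z - p) \<bullet> (v - p)))
        \<le> (1 - s) * (d * ?K) + s * (d * ?K)"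
      using s by (intro add_mono mult_left_mono) auto
    also have "(1 - s) * (2 * R * ((z - p) \<bullet> (u - p))) + s * (2 * R * ((z - p) \<bullet> (v - p)))
        = 2 * R * ((z - p) \<bullet> ((1 - s) *\<^sub>R (u - p) + s *\<^sub>R (v - p)))"
      by (simp add: inner_add_right algebra_simps)
    also have "(1 - s) *\<^sub>R (u - p) + s *\<^sub>R (v - p) = z - p" by (simp add: z_def algebra_simps)
    also have "(z - p) \<bullet> (z - p) = d * d" unfolding zp[symmetric] by (simp add: norm_eq_sqrt_inner)
    finally have "d * (2 * R * d) \<le> d * ?K" by (simp add: algebra_simps)
    then have "2 * R * d \<le> ?K" using False d by simp
    moreover have "2 * R * dist m p \<le> 2 * R * d" using hd R by simp
    ultimately show ?thesis by linarith
  qed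
  have strict: "dist m p < dist m q" if q: "q \<in> A \<inter> slice_hyperplane u v m" "q \<noteq> p" for q
  proof -
    have qw: "(q - m) \<bullet> w = 0" using q orth by blast
    have "w \<bullet> (q - p) = 0"
      using qw pw inner_diff_left[of "q - m" "p - m" w] by (simp add: inner_commute)
    moreover have "z - p = (m - p) + (2 * s - 1) *\<^sub>R w" by (simp add: zm)
    ultimately have "(z - p) \<bullet> (q - p) = (m - p) \<bullet> (q - p)"
      by (simp only: inner_add_left inner_scaleR_left mult_zero_right add_0_right)
    then have 1: "2 * R * ((m - p) \<bullet> (q - p)) \<le> d * (dist q p)\<^sup>2" using prox[of q] q by simp
    \<comment> \<open>Here \<open>d < R\<close> makes the inequality strict, and with it the
      slice-projection unique.\<close>
    also have "\<dots> < R * (dist q p)\<^sup>2" using d q by (intro mult_strict_right_mono) auto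
    finally have "R * (2 * ((m - p) \<bullet> (q - p))) < R * (dist q p)\<^sup>2" by (simp add: algebra_simps)
    then have "2 * ((m - p) \<bullet> (q - p)) < (dist q p)\<^sup>2" using R by simp
    moreover have "(dist m q)\<^sup>2 = (dist m p)\<^sup>2 - 2 * ((m - p) \<bullet> (q - p)) + (dist q p)\<^sup>2"
      using power2_norm_scaleR_diff[of 1 "m - p" "q - p"] by (simp add: dist_norm)
    ultimately have "(dist m p)\<^sup>2 < (dist m q)\<^sup>2" by linarith
    then show ?thesis by (rule power2_less_imp_less) simp
  qed
  have pH: "p \<in> A \<inter> slice_hyperplane u v m" using pA H unfolding m_def by blast
  show thesis
  proof (rule that)
    show "slice_projection A u v (midpoint u v) p"
    proof -
      have "\<not> dist m q < dist m p" if "q \<in> A \<inter> slice_hyperplane u v m" for q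
        using strict[OF that] by (cases "q = p") auto
      then show ?thesis using pH unfolding slice_projection_def is_arg_min_def m_def[symmetric] by blast
    qed
    show "q = p" if "slice_projection A u v (midpoint u v) q" for q
      using that pH strict unfolding slice_projection_def is_arg_min_def m_def[symmetric] by blast
    show "dist (midpoint u v) p < R" using hd d unfolding m_def[symmetric] by linarith
  qed (fact pA h[unfolded m_def] up[unfolded m_def] vp[unfolded m_def])+
qed

text \<open>Here \<open>\<phi>\<close> is half the central angle of a chord of a circle of radius \<open>R\<close>.\<close>

definition short_chord :: "real \<Rightarrow> 'a::metric_space set \<Rightarrow> real \<Rightarrow> 'a \<Rightarrow> 'a \<Rightarrow> bool" where
  "short_chord R A \<phi> u v \<longleftrightarrow> u \<in> A \<and> v \<in> A \<and> u \<noteq> v \<and> dist u v \<le> 2 * R * sin \<phi>"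

text \<open>The height is at most \<open>R * (1 - cos \<phi>)\<close> and the half chord at most
  \<open>R * sin \<phi>\<close>; Pythagoras and the half-angle formula give the new chords. For
  containment, the parallelogram law puts the centre of any admissible ball within \<open>R\<close>
  minus the sagitta of the midpoint.\<close>

lemma slice_projection_halves_chord:
  fixes A :: "'a::{real_inner,complete_space} set"
  assumes A: "proximally_smooth R A" and R: "R > 0"
    and \<phi>: "0 \<le> \<phi>" "\<phi> < pi / 2" and uv: "short_chord R A \<phi> u v"
  shows "\<exists>!p. slice_projection A u v (midpoint u v) p"
    and "slice_projection A u v (midpoint u v) p \<Longrightarrow>
      short_chord R A (\<phi> / 2) u p \<and> short_chord R A (\<phi> / 2) p v \<and> p \<in> strongly_convex_segment R u v"
proof -
  define m where "m = midpoint u v"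
  have uv': "u \<in> A" "v \<in> A" "u \<noteq> v" "dist u v \<le> 2 * R * sin \<phi>"
    using uv by (auto simp: short_chord_def)
  have "sin \<phi> < 1" using sin_monotone_2pi[of \<phi> "pi / 2"] \<phi> by simp
  then have l: "dist u v < 2 * R" using uv'(4) R by (auto intro: le_less_trans)
  obtain q where q: "slice_projection A u v m q" "\<And>p. slice_projection A u v m p \<Longrightarrow> p = q"
    "q \<in> A" "dist m q < R" "2 * R * dist m q \<le> (dist m q)\<^sup>2 + (dist u v / 2)\<^sup>2"
    "(dist u q)\<^sup>2 = (dist m q)\<^sup>2 + (dist u v / 2)\<^sup>2"
    "(dist q v)\<^sup>2 = (dist m q)\<^sup>2 + (dist u v / 2)\<^sup>2"
    using slice_projection_midpoint[OF A uv'(1,2) l] unfolding m_def by blast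
  show "\<exists>!p. slice_projection A u v (midpoint u v) p" using q(1,2) unfolding m_def by blast
  \<comment> \<open>The quadratic inequality also allows heights beyond its larger root;
    \<open>dist m q < R\<close> selects the smaller one.\<close>
  have sagitta: "dist m q \<le> R - sqrt (R\<^sup>2 - (dist u v / 2)\<^sup>2)"
  proof -
    have "R\<^sup>2 - (dist u v / 2)\<^sup>2 \<le> (R - dist m q)\<^sup>2" using q(5) by (simp add: power2_diff)
    then have "sqrt (R\<^sup>2 - (dist u v / 2)\<^sup>2) \<le> R - dist m q" using q(4) by (intro real_le_lsqrt) auto
    then show ?thesis by simp
  qed
  have half: "(dist u v / 2)\<^sup>2 \<le> (R * sin \<phi>)\<^sup>2" using uv'(4) by (intro power_mono) auto
  have c0: "cos \<phi> \<ge> 0" using \<phi> by (intro cos_ge_zero) auto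
  have "(R * cos \<phi>)\<^sup>2 \<le> R\<^sup>2 - (dist u v / 2)\<^sup>2"
    using half by (simp add: power_mult_distrib cos_squared_eq right_diff_distrib)
  then have "R * cos \<phi> \<le> sqrt (R\<^sup>2 - (dist u v / 2)\<^sup>2)" by (rule real_le_rsqrt)
  then have "dist m q \<le> R * (1 - cos \<phi>)" using sagitta by (simp add: algebra_simps)
  then have "(dist m q)\<^sup>2 \<le> (R * (1 - cos \<phi>))\<^sup>2" by (intro power_mono) auto
  then have "(dist m q)\<^sup>2 + (dist u v / 2)\<^sup>2 \<le> (R * (1 - cos \<phi>))\<^sup>2 + (R * sin \<phi>)\<^sup>2"
    using half by linarith
  also have "\<dots> = R\<^sup>2 * ((1 - cos \<phi>)\<^sup>2 + (sin \<phi>)\<^sup>2)"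
    by (simp add: power_mult_distrib distrib_left)
  also have "(1 - cos \<phi>)\<^sup>2 + (sin \<phi>)\<^sup>2 = 2 * (1 - cos \<phi>)"
    by (simp add: sin_squared_eq power2_diff)
  also have "cos \<phi> = 1 - 2 * (sin (\<phi> / 2))\<^sup>2" using cos_double_sin[of "\<phi> / 2"] by simp
  also have "R\<^sup>2 * (2 * (1 - (1 - 2 * (sin (\<phi> / 2))\<^sup>2))) = (2 * R * sin (\<phi> / 2))\<^sup>2"
    by (simp add: power_mult_distrib)
  finally have K: "(dist m q)\<^sup>2 + (dist u v / 2)\<^sup>2 \<le> (2 * R * sin (\<phi> / 2))\<^sup>2" .
  have s0: "0 \<le> 2 * R * sin (\<phi> / 2)" using R \<phi> by (simp add: sin_ge_zero)
  have "dist u q \<le> 2 * R * sin (\<phi> / 2)" "dist q v \<le> 2 * R * sin (\<phi> / 2)"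
    using K q(6,7) s0 by (auto intro: power2_le_imp_le)
  \<comment> \<open>A positive half chord keeps the new point away from both endpoints, so the
    bisection can continue.\<close>
  moreover have "(dist u v / 2)\<^sup>2 > 0" using uv'(3) by simp
  then have "0 < (dist u q)\<^sup>2" "0 < (dist q v)\<^sup>2"
    unfolding q(6,7) by (simp_all add: add_nonneg_pos)
  then have "u \<noteq> q" "q \<noteq> v" by auto
  moreover have "q \<in> strongly_convex_segment R u v"
    unfolding strongly_convex_segment_def
  proof (clarsimp)
    fix c assume c: "dist c u \<le> R" "dist c v \<le> R"
    define w where "w = (1 / 2) *\<^sub>R (v - u)"
    have w: "norm w = dist u v / 2" by (simp add: w_def dist_norm norm_minus_commute)
    have uvm: "u = m - w" "v = m + w" unfolding m_def w_def by (fact endpoints_via_midpoint)+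
    have cu: "c - u = (c - m) + w" "c - v = (c - m) - w"
      by (simp_all add: uvm)
    have "(dist c u)\<^sup>2 + (dist c v)\<^sup>2 = 2 * (dist c m)\<^sup>2 + 2 * (norm w)\<^sup>2"
      using power2_norm_scaleR_diff[of 1 "c - m" w] power2_norm_scaleR_diff[of 1 "c - m" "- w"]
      unfolding dist_norm cu by simp
    then have "(dist c m)\<^sup>2 = ((dist c u)\<^sup>2 + (dist c v)\<^sup>2) / 2 - (dist u v / 2)\<^sup>2"
      unfolding w by (simp add: add_divide_distrib)
    also have "\<dots> \<le> (R\<^sup>2 + R\<^sup>2) / 2 - (dist u v / 2)\<^sup>2"
      using power_mono[OF c(1), of 2] power_mono[OF c(2), of 2] by simp
    finally have "dist c m \<le> sqrt (R\<^sup>2 - (dist u v / 2)\<^sup>2)" by (intro real_le_rsqrt) simp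
    then show "dist c q \<le> R" using sagitta dist_triangle[of c q m] by linarith
  qed
  moreover assume "slice_projection A u v (midpoint u v) p"
  then have "p = q" using q(2) m_def by blast
  ultimately show "short_chord R A (\<phi> / 2) u p \<and> short_chord R A (\<phi> / 2) p v \<and> p \<in> strongly_convex_segment R u v"
    using q(3) uv' by (auto simp: short_chord_def)
qed

section \<open>Bisection on dyadic grids: estimates, uniqueness, existence\<close>

text \<open>A ball of radius \<open>R\<close> around \<open>u\<close> and \<open>v\<close> contains
  \<open>a\<close> and \<open>b\<close> too, so it is among the balls defining the smaller segment.
  This passes containment down the bisection levels.\<close>

lemma strongly_convex_segment_subset:
  assumes "a \<in> strongly_convex_segment R u v" "b \<in> strongly_convex_segment R u v"
  shows "strongly_convex_segment R a b \<subseteq> strongly_convex_segment R u v"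
  using assms unfolding strongly_convex_segment_def by blast

lemma closed_strongly_convex_segment: "closed (strongly_convex_segment R u v)"
  unfolding strongly_convex_segment_def by (intro closed_Inter) auto

lemma endpoints_in_strongly_convex_segment:
  "u \<in> strongly_convex_segment R u v" "v \<in> strongly_convex_segment R u v"
  unfolding strongly_convex_segment_def by auto

lemma divide_power_two_less:
  fixes x y :: real
  assumes "0 \<le> x" "x < y"
  shows "x / 2 ^ n < y"
proof -
  have "x / 2 ^ n \<le> x / 1" using assms by (intro divide_left_mono) auto
  then show ?thesis using assms by simp
qed

text \<open>An abstract \<open>G\<close> lets the estimate serve both a given run of the procedure
  and the grid built by recursion. The rule \<open>odd\<close> is conditional on distinct endpoints
  and a unique projection because the induction itself supplies these facts from the chord
  bound.\<close>

lemma bisection_grid_short_chord: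
  fixes A :: "'a::{real_inner,complete_space} set" and G :: "nat \<Rightarrow> nat \<Rightarrow> 'a"
  assumes A: "proximally_smooth R A" and R: "R > 0"
    and \<theta>: "0 \<le> \<theta>" "\<theta> < pi / 2" and chord: "short_chord R A \<theta> (G 0 0) (G 0 1)"
    and even: "\<And>i j. j \<le> 2 ^ i \<Longrightarrow> G (Suc i) (2 * j) = G i j"
    and odd: "\<And>i j. j < 2 ^ i \<Longrightarrow> G i j \<noteq> G i (Suc j) \<Longrightarrow>
      \<exists>!p. slice_projection A (G i j) (G i (Suc j)) (midpoint (G i j) (G i (Suc j))) p \<Longrightarrow>
      slice_projection A (G i j) (G i (Suc j)) (midpoint (G i j) (G i (Suc j))) (G (Suc i) (Suc (2 * j)))"
  shows "j < 2 ^ i \<Longrightarrow> short_chord R A (\<theta> / 2 ^ i) (G i j) (G i (Suc j)) \<and>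
    G i j \<in> strongly_convex_segment R (G 0 0) (G 0 1) \<and>
    G i (Suc j) \<in> strongly_convex_segment R (G 0 0) (G 0 1)"
proof (induction i arbitrary: j)
  case 0
  then show ?case using chord by (simp add: endpoints_in_strongly_convex_segment)
next
  case (Suc i)
  define k where "k = j div 2"
  have k: "k < 2 ^ i" using Suc.prems by (simp add: k_def less_mult_imp_div_less mult.commute)
  let ?\<phi> = "\<theta> / 2 ^ i" and ?u = "G i k" and ?v = "G i (Suc k)" and ?p = "G (Suc i) (Suc (2 * k))"
  have IH: "short_chord R A ?\<phi> ?u ?v" "?u \<in> strongly_convex_segment R (G 0 0) (G 0 1)"
    "?v \<in> strongly_convex_segment R (G 0 0) (G 0 1)"
    using Suc.IH[OF k] by auto
  have \<phi>: "0 \<le> ?\<phi>" "?\<phi> < pi / 2" by (simp add: \<theta>, rule divide_power_two_less[OF \<theta>])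
  have "slice_projection A ?u ?v (midpoint ?u ?v) ?p"
    using odd[OF k] slice_projection_halves_chord(1)[OF A R \<phi> IH(1)] IH(1) by (simp add: short_chord_def)
  then have p: "short_chord R A (?\<phi> / 2) ?u ?p" "short_chord R A (?\<phi> / 2) ?p ?v"
    "?p \<in> strongly_convex_segment R (G 0 0) (G 0 1)"
    using slice_projection_halves_chord(2)[OF A R \<phi> IH(1)] strongly_convex_segment_subset[OF IH(2,3)] by auto
  have ev: "G (Suc i) (2 * k) = ?u" "G (Suc i) (Suc (Suc (2 * k))) = ?v"
    using even[of k i] even[of "Suc k" i] k by auto
  have "j = 2 * k \<or> j = Suc (2 * k)" unfolding k_def by presburger
  then show ?case using p IH ev by (auto simp: mult.commute)
qed

text \<open>Shifting both indices by one removes the truncated subtraction \<open>i - 1\<close> and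
  gives a form suited to induction on the level.\<close>

lemma slice_bisection_alt:
  "slice_bisection A x0 x1 f \<longleftrightarrow> f 0 = x0 \<and> f 1 = x1 \<and>
    (\<forall>i j. j < 2 ^ i \<longrightarrow>
      (let u = f (real j / 2 ^ i); v = f (real (Suc j) / 2 ^ i)
       in u \<noteq> v \<and> (\<exists>!p. slice_projection A u v (midpoint u v) p) \<and>
          slice_projection A u v (midpoint u v) (f (real (Suc (2 * j)) / 2 ^ Suc i))))"
proof -
  have "(\<forall>i\<ge>1. \<forall>j\<in>{1..2 ^ (i - 1)}. Q i j) \<longleftrightarrow> (\<forall>i j. j < 2 ^ i \<longrightarrow> Q (Suc i) (Suc j))"
    for Q :: "nat \<Rightarrow> nat \<Rightarrow> bool"
  proof (intro iffI allI impI ballI)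
    fix i j :: nat assume Q: "\<forall>i j. j < 2 ^ i \<longrightarrow> Q (Suc i) (Suc j)" and "1 \<le> i" "j \<in> {1..2 ^ (i - 1)}"
    then have "j - 1 < 2 ^ (i - 1)" and eq: "Suc (i - 1) = i" "Suc (j - 1) = j" by auto
    then have "Q (Suc (i - 1)) (Suc (j - 1))" using Q by blast
    then show "Q i j" unfolding eq .
  qed auto
  note * = this
  show ?thesis unfolding slice_bisection_def * by (simp add: add.commute)
qed

lemma slice_bisection_short_chord:
  fixes A :: "'a::{real_inner,complete_space} set"
  assumes A: "proximally_smooth R A" and R: "R > 0"
    and \<theta>: "0 \<le> \<theta>" "\<theta> < pi / 2" and chord: "short_chord R A \<theta> x0 x1"
    and f: "slice_bisection A x0 x1 f" and j: "j < 2 ^ i"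
  shows "short_chord R A (\<theta> / 2 ^ i) (f (real j / 2 ^ i)) (f (real (Suc j) / 2 ^ i))"
    and "f (real j / 2 ^ i) \<in> strongly_convex_segment R x0 x1"
proof -
  have f01: "f 0 = x0" "f 1 = x1" using f by (auto simp: slice_bisection_def)
  let ?G = "\<lambda>i j :: nat. f (real j / 2 ^ i)"
  have "short_chord R A (\<theta> / 2 ^ i) (?G i j) (?G i (Suc j)) \<and>
    ?G i j \<in> strongly_convex_segment R (?G 0 0) (?G 0 1) \<and>
    ?G i (Suc j) \<in> strongly_convex_segment R (?G 0 0) (?G 0 1)"
  proof (rule bisection_grid_short_chord[OF A R \<theta> _ _ _ j])
    show "short_chord R A \<theta> (?G 0 0) (?G 0 1)" using chord f01 by simp
    show "?G (Suc i) (2 * j) = ?G i j" for i j by simp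
    show "slice_projection A (?G i j) (?G i (Suc j)) (midpoint (?G i j) (?G i (Suc j))) (?G (Suc i) (Suc (2 * j)))"
      if "j < 2 ^ i" for i j
      using f that unfolding slice_bisection_alt Let_def by blast
  qed
  then show "short_chord R A (\<theta> / 2 ^ i) (f (real j / 2 ^ i)) (f (real (Suc j) / 2 ^ i))"
    and "f (real j / 2 ^ i) \<in> strongly_convex_segment R x0 x1"
    using f01 by auto
qed

text \<open>Even indices repeat a value of the previous level; odd ones are forced by the uniqueness
  that every run includes.\<close>

lemma slice_bisection_unique:
  assumes f: "slice_bisection A x0 x1 f" and g: "slice_bisection A x0 x1 g"
  shows "j \<le> 2 ^ i \<Longrightarrow> f (real j / 2 ^ i) = g (real j / 2 ^ i)"
proof (induction i arbitrary: j)
  case 0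
  then have "j = 0 \<or> j = 1" by auto
  then show ?case using f g by (auto simp: slice_bisection_def)
next
  case (Suc i)
  define k where "k = j div 2"
  have "j = 2 * k \<or> j = Suc (2 * k)" unfolding k_def by presburger
  then show ?case
  proof
    assume "j = 2 * k"
    then show ?thesis using Suc.IH[of k] Suc.prems by simp
  next
    assume j: "j = Suc (2 * k)"
    then have k: "k < 2 ^ i" using Suc.prems by simp
    define u v where "u = f (real k / 2 ^ i)" and "v = f (real (Suc k) / 2 ^ i)"
    have uv: "u = g (real k / 2 ^ i)" "v = g (real (Suc k) / 2 ^ i)"
      unfolding u_def v_def using Suc.IH[of k] Suc.IH[of "Suc k"] k by simp_all
    have "\<exists>!p. slice_projection A u v (midpoint u v) p"
      "slice_projection A u v (midpoint u v) (f (real j / 2 ^ Suc i))"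
      using f k unfolding slice_bisection_alt Let_def j u_def v_def by blast+
    moreover have "slice_projection A u v (midpoint u v) (g (real j / 2 ^ Suc i))"
      using g k unfolding slice_bisection_alt Let_def j uv by blast
    ultimately show ?thesis by blast
  qed
qed

text \<open>The value at \<open>j / 2 ^ i\<close>, indexed by \<open>i\<close> and \<open>j\<close> so that it can be defined by recursion.\<close>

fun bisection_grid :: "'a::real_inner set \<Rightarrow> 'a \<Rightarrow> 'a \<Rightarrow> nat \<Rightarrow> nat \<Rightarrow> 'a" where
  "bisection_grid A x0 x1 0 j = (if j = 0 then x0 else x1)"
| "bisection_grid A x0 x1 (Suc i) j =
     (let u = bisection_grid A x0 x1 i (j div 2); v = bisection_grid A x0 x1 i (Suc (j div 2))
      in if even j then u else (SOME p. slice_projection A u v (midpoint u v) p))"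

declare bisection_grid.simps(2) [simp del]

lemma bisection_grid_even: "bisection_grid A x0 x1 (Suc i) (2 * j) = bisection_grid A x0 x1 i j"
  by (simp add: bisection_grid.simps(2) Let_def)

lemma bisection_grid_refine: "bisection_grid A x0 x1 (k + i) (2 ^ k * j) = bisection_grid A x0 x1 i j"
  by (induction k) (simp_all add: bisection_grid_even mult.assoc)

text \<open>Both index pairs refine to the same index at level \<open>i + i'\<close>, so the grid
  value depends only on the dyadic number.\<close>

lemma bisection_grid_eq:
  assumes "real j / 2 ^ i = real j' / 2 ^ i'"
  shows "bisection_grid A x0 x1 i j = bisection_grid A x0 x1 i' j'"
proof -
  have "real (2 ^ i' * j) = real (2 ^ i * j')" using assms by (simp add: field_simps)
  then have "2 ^ i' * j = 2 ^ i * j'" by (simp only: of_nat_eq_iff)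
  then show ?thesis by (metis add.commute bisection_grid_refine)
qed

text \<open>Since \<open>bisection_grid\<close> chooses with \<open>SOME\<close>, it is total; the
  chord estimate shows afterwards that every choice within the grid was the unique
  slice-projection.\<close>

lemma slice_bisection_exists:
  fixes A :: "'a::{real_inner,complete_space} set"
  assumes A: "proximally_smooth R A" and R: "R > 0"
    and \<theta>: "0 \<le> \<theta>" "\<theta> < pi / 2" and chord: "short_chord R A \<theta> x0 x1"
  obtains f where "slice_bisection A x0 x1 f"
proof -
  let ?G = "bisection_grid A x0 x1"
  define f where "f t = (SOME p. \<exists>i j. t = real j / 2 ^ i \<and> p = ?G i j)" for t :: real
  have f: "f (real j / 2 ^ i) = ?G i j" for i j
    unfolding f_def
  proof (rule some_equality)
    fix p assume "\<exists>i' j'. real j / 2 ^ i = real j' / 2 ^ i' \<and> p = ?G i' j'"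
    then show "p = ?G i j"
    proof (elim exE conjE)
      fix i' j' assume eq: "real j / 2 ^ i = real j' / 2 ^ i'" and p: "p = ?G i' j'"
      show "p = ?G i j" unfolding p by (rule bisection_grid_eq[OF eq[symmetric]])
    qed
  qed (rule exI[of _ i], rule exI[of _ j], simp)
  have odd: "slice_projection A (?G i j) (?G i (Suc j)) (midpoint (?G i j) (?G i (Suc j))) (?G (Suc i) (Suc (2 * j)))"
    if "\<exists>!p. slice_projection A (?G i j) (?G i (Suc j)) (midpoint (?G i j) (?G i (Suc j))) p" for i j
    using that by (simp add: bisection_grid.simps(2) Let_def) (metis someI)
  have arc: "short_chord R A (\<theta> / 2 ^ i) (?G i j) (?G i (Suc j))" if "j < 2 ^ i" for i j
    using bisection_grid_short_chord[OF A R \<theta>, of ?G, OF _ _ _ that] chord odd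
    by (simp add: bisection_grid_even)
  have "slice_bisection A x0 x1 f"
    unfolding slice_bisection_alt Let_def f
  proof (intro conjI allI impI)
    show "f 0 = x0" "f 1 = x1" using f[of 0 0] f[of 1 0] by auto
    fix i j :: nat assume j: "j < 2 ^ i"
    have \<phi>: "0 \<le> \<theta> / 2 ^ i" "\<theta> / 2 ^ i < pi / 2" by (simp add: \<theta>, rule divide_power_two_less[OF \<theta>])
    show "?G i j \<noteq> ?G i (Suc j)" using arc[OF j] by (simp add: short_chord_def)
    show ex: "\<exists>!p. slice_projection A (?G i j) (?G i (Suc j)) (midpoint (?G i j) (?G i (Suc j))) p"
      using slice_projection_halves_chord(1)[OF A R \<phi> arc[OF j]] .
    show "slice_projection A (?G i j) (?G i (Suc j)) (midpoint (?G i j) (?G i (Suc j))) (?G (Suc i) (Suc (2 * j)))"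
      using odd[OF ex] .
  qed
  then show thesis by (rule that)
qed

section \<open>Lipschitz extension from the dyadic points and curve length\<close>

lemma dyadic_grid_mono: "i \<le> k \<Longrightarrow> dyadic_grid i \<subseteq> dyadic_grid k"
proof
  fix t assume "i \<le> k" "t \<in> dyadic_grid i"
  then obtain j where j: "t = real j / 2 ^ i" "j \<le> 2 ^ i" by (auto simp: dyadic_grid_def)
  have k: "(2::nat) ^ k = 2 ^ (k - i) * 2 ^ i" "(2::real) ^ k = 2 ^ (k - i) * 2 ^ i"
    using \<open>i \<le> k\<close> by (simp_all flip: power_add)
  have "t = real (2 ^ (k - i) * j) / 2 ^ k" unfolding k(2) by (simp add: j)
  moreover have "2 ^ (k - i) * j \<le> 2 ^ k" using j(2) unfolding k(1) by simp
  ultimately show "t \<in> dyadic_grid k" unfolding dyadic_grid_def by blast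
qed

lemma dyadic_grid_subset: "dyadic_grid i \<subseteq> {0..1}"
proof -
  have "real j / 2 ^ i \<le> 1" if "j \<le> 2 ^ i" for j
  proof -
    have "real j \<le> real (2 ^ i)" using that by (simp only: of_nat_le_iff)
    then show ?thesis by simp
  qed
  then show ?thesis by (auto simp: dyadic_grid_def)
qed

lemma closure_dyadic_grid: "closure (\<Union>i. dyadic_grid i) = {0..1}"
proof -
  have "{0..1} \<inter> (\<Union>k m. {of_nat m / 2^k}) \<subseteq> (\<Union>i. dyadic_grid i)"
  proof
    fix t :: real assume "t \<in> {0..1} \<inter> (\<Union>k m. {of_nat m / 2^k})"
    then obtain k m where t: "t = real m / 2 ^ k" "t \<le> 1" by auto
    then have "real m / 2 ^ k \<le> 1" by simp
    then have "real m \<le> real (2 ^ k)" by (simp add: divide_le_eq_1)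
    then have "m \<le> 2 ^ k" by (simp only: of_nat_le_iff)
    then show "t \<in> (\<Union>i. dyadic_grid i)" using t by (auto simp: dyadic_grid_def)
  qed
  note sub = closure_mono[OF this]
  have "closure ({0..1} \<inter> (\<Union>k m. {of_nat m / 2^k})) = closure {0..1::real}"
    by (rule closure_dyadic_rationals_in_convex_set_pos_1) auto
  then have "closure {0..1} \<subseteq> closure (\<Union>i. dyadic_grid i)" using sub by argo
  moreover have "closure (\<Union>i. dyadic_grid i) \<subseteq> {0..1}"
    using dyadic_grid_subset by (intro closure_minimal) auto
  ultimately show ?thesis by simp
qed

text \<open>Two dyadic points lie in a common grid, where the neighbour bounds add up along the
  points between them; the resulting constant \<open>C\<close> does not depend on the level.\<close>

lemma lipschitz_on_dyadic_grids:
  fixes f :: "real \<Rightarrow> 'a::metric_space"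
  assumes C: "C \<ge> 0" and f: "\<And>i j. j < 2 ^ i \<Longrightarrow> dist (f (real j / 2 ^ i)) (f (real (Suc j) / 2 ^ i)) \<le> C / 2 ^ i"
  shows "C-lipschitz_on (\<Union>i. dyadic_grid i) f"
proof -
  have chain: "dist (f (real j / 2 ^ i)) (f (real k / 2 ^ i)) \<le> C / 2 ^ i * (real k - real j)"
    if "j \<le> k" "k \<le> 2 ^ i" for i j k
    using that
  proof (induction k rule: dec_induct)
    case (step k)
    have "dist (f (real j / 2 ^ i)) (f (real (Suc k) / 2 ^ i))
        \<le> dist (f (real j / 2 ^ i)) (f (real k / 2 ^ i)) + dist (f (real k / 2 ^ i)) (f (real (Suc k) / 2 ^ i))"
      by (rule dist_triangle)
    also have "\<dots> \<le> C / 2 ^ i * (real k - real j) + C / 2 ^ i"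
      using step f[of k i] by (intro add_mono) auto
    also have "\<dots> = C / 2 ^ i * (real (Suc k) - real j)"
      by (simp only: of_nat_Suc right_diff_distrib distrib_left mult_1_right)
    finally show ?case .
  qed simp
  show ?thesis
  proof (rule lipschitz_on_leI)
    fix s t :: real assume "s \<in> (\<Union>i. dyadic_grid i)" "t \<in> (\<Union>i. dyadic_grid i)" and st: "s \<le> t"
    then obtain i i' where "s \<in> dyadic_grid i" "t \<in> dyadic_grid i'" by blast
    then have "s \<in> dyadic_grid (max i i')" "t \<in> dyadic_grid (max i i')"
      using dyadic_grid_mono max.cobounded1 max.cobounded2 by blast+
    then obtain k a b where k: "s = real a / 2 ^ k" "t = real b / 2 ^ k" "b \<le> 2 ^ k"
      by (auto simp: dyadic_grid_def)
    then have "a \<le> b" using st by (simp add: divide_le_cancel)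
    then have "dist (f s) (f t) \<le> C / 2 ^ k * (real b - real a)" using chain[of a b k] k by simp
    also have "\<dots> = C * dist s t" using st by (simp add: k dist_real_def diff_divide_distrib[symmetric] \<open>a \<le> b\<close> abs_minus_commute)
    finally show "dist (f s) (f t) \<le> C * dist s t" .
  qed (rule C)
qed

lemma curve_length_lipschitz:
  assumes "C-lipschitz_on {a..b} f"
  shows "curve_length f a b \<le> ennreal (C * (b - a))"
  unfolding curve_length_def
proof (rule SUP_least, clarify)
  fix n :: nat and t :: "nat \<Rightarrow> real"
  assume t: "\<forall>i\<le>n. t i \<in> {a..b}" "\<forall>i<n. t i \<le> t (Suc i)"
  have C: "C \<ge> 0" using assms by (rule lipschitz_on_nonneg)
  have "(\<Sum>i<n. ennreal (dist (f (t i)) (f (t (Suc i))))) = ennreal (\<Sum>i<n. dist (f (t i)) (f (t (Suc i))))"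
    by (simp add: sum_ennreal)
  also have "\<dots> \<le> ennreal (\<Sum>i<n. C * (t (Suc i) - t i))"
  proof (intro ennreal_leI sum_mono)
    fix i assume "i \<in> {..<n}"
    then show "dist (f (t i)) (f (t (Suc i))) \<le> C * (t (Suc i) - t i)"
      using lipschitz_onD[OF assms, of "t i" "t (Suc i)"] t by (simp add: dist_real_def)
  qed
  also have "(\<Sum>i<n. C * (t (Suc i) - t i)) = C * (t n - t 0)"
    by (simp add: sum_lessThan_telescope flip: sum_distrib_left)
  also have "ennreal \<dots> \<le> ennreal (C * (b - a))"
    using t(1) C by (intro ennreal_leI mult_left_mono diff_mono) auto
  finally show "(\<Sum>i<n. ennreal (dist (f (t i)) (f (t (Suc i))))) \<le> ennreal (C * (b - a))" .
qed

theorem lemma4p2: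
  fixes A :: "'a::{real_inner,complete_space} set" and x0 x1 :: 'a and R :: real
  assumes dim: "\<exists>B :: 'a set. independent B \<and> card B = 2"
    and R: "R > 0"
    and A: "proximally_smooth R A"
    and x: "x0 \<in> A" "x1 \<in> A" "x0 \<noteq> x1" "dist x0 x1 < 2 * R"
  shows "(\<exists>f. slice_bisection A x0 x1 f) \<and>
         (\<forall>f g. slice_bisection A x0 x1 f \<and> slice_bisection A x0 x1 g \<longrightarrow>
            (\<forall>t \<in> (\<Union>i. dyadic_grid i). f t = g t)) \<and>
         (\<forall>f. slice_bisection A x0 x1 f \<longrightarrow>
            (\<exists>F :: real \<Rightarrow> 'a.
               (\<forall>t \<in> (\<Union>i. dyadic_grid i). F t = f t) \<and>
               continuous_on {0..1} F \<and>
               F ` {0..1} \<subseteq> A \<inter> strongly_convex_segment R x0 x1 \<and>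
               F 0 = x0 \<and> F 1 = x1 \<and>
               curve_length F 0 1 < \<infinity> \<and>
               curve_length F 0 1 \<le> ennreal (2 * R * arcsin (dist x0 x1 / (2 * R)))))"
proof (intro conjI allI impI)
  \<comment> \<open>Half the central angle of the initial chord, so that \<open>short_chord\<close>
    holds with equality at level 0.\<close>
  define \<theta> where "\<theta> = arcsin (dist x0 x1 / (2 * R))"
  have l: "0 \<le> dist x0 x1 / (2 * R)" "dist x0 x1 / (2 * R) < 1" using x R by auto
  have \<theta>: "0 \<le> \<theta>" "\<theta> < pi / 2"
    using l arcsin_lt_bounded[of "dist x0 x1 / (2 * R)"] by (auto simp: \<theta>_def arcsin_nonneg)
  have "sin \<theta> = dist x0 x1 / (2 * R)" unfolding \<theta>_def using l by (intro sin_arcsin) linarith+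
  then have chord: "short_chord R A \<theta> x0 x1" using x R by (simp add: short_chord_def)
  show "\<exists>f. slice_bisection A x0 x1 f" using slice_bisection_exists[OF A R \<theta> chord] by blast
  show "\<forall>t \<in> (\<Union>i. dyadic_grid i). f t = g t"
    if "slice_bisection A x0 x1 f \<and> slice_bisection A x0 x1 g" for f g
    using slice_bisection_unique[of A x0 x1 f g] that by (auto simp: dyadic_grid_def)
  fix f assume f: "slice_bisection A x0 x1 f"
  \<comment> \<open>The length of the arc of radius \<open>R\<close> over the chord; since
    \<open>sin x \<le> x\<close> for nonnegative \<open>x\<close>, a chord of level \<open>i\<close>
    is at most its share \<open>C / 2 ^ i\<close>.\<close>
  define C where "C = 2 * R * \<theta>"
  have C: "C \<ge> 0" using R \<theta> by (simp add: C_def)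
  note grid = slice_bisection_short_chord[OF A R \<theta> chord f]
  have f01: "f 0 = x0" "f 1 = x1" using f by (auto simp: slice_bisection_def)
  have "C-lipschitz_on (\<Union>i. dyadic_grid i) f"
  proof (rule lipschitz_on_dyadic_grids[OF C])
    fix i j :: nat assume "j < 2 ^ i"
    then have "dist (f (real j / 2 ^ i)) (f (real (Suc j) / 2 ^ i)) \<le> 2 * R * sin (\<theta> / 2 ^ i)"
      using grid(1) by (simp add: short_chord_def)
    also have "\<dots> \<le> 2 * R * (\<theta> / 2 ^ i)" using \<theta> R by (intro mult_left_mono sin_x_le_x) auto
    finally show "dist (f (real j / 2 ^ i)) (f (real (Suc j) / 2 ^ i)) \<le> C / 2 ^ i" by (simp add: C_def)
  qed
  \<comment> \<open>Completeness extends the Lipschitz map to the closure of the dyadic points, with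
    the same constant; this constant is also the length bound on \<open>{0..1}\<close>.\<close>
  then obtain F where F: "C-lipschitz_on {0..1} F" "\<And>t. t \<in> (\<Union>i. dyadic_grid i) \<Longrightarrow> F t = f t"
    using lipschitz_extend_closure[of C "\<Union>i. dyadic_grid i" f] unfolding closure_dyadic_grid by blast
  have cont: "continuous_on {0..1} F" using F(1) by (rule lipschitz_on_continuous_on)
  have in_segment: "f (real j / 2 ^ i) \<in> A \<inter> strongly_convex_segment R x0 x1" if "j \<le> 2 ^ i" for i j
  proof (cases "j = 2 ^ i")
    \<comment> \<open>The last grid point is not the left end of any cell, so \<open>grid\<close>
      does not cover it.\<close>
    case True
    then show ?thesis using x f01 endpoints_in_strongly_convex_segment by simp
  next
    case False
    then show ?thesis using grid[of j i] that by (simp add: short_chord_def)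
  qed
  have "F ` (\<Union>i. dyadic_grid i) \<subseteq> A \<inter> strongly_convex_segment R x0 x1"
  proof (rule image_subsetI)
    fix t assume t: "t \<in> (\<Union>i. dyadic_grid i)"
    then obtain i j where "t = real j / 2 ^ i" "j \<le> 2 ^ i" by (auto simp: dyadic_grid_def)
    then show "F t \<in> A \<inter> strongly_convex_segment R x0 x1" using in_segment F(2)[OF t] by simp
  qed
  \<comment> \<open>Both \<open>A\<close> and the strongly convex segment are closed, so membership
    passes to limits of dyadic points.\<close>
  then have "F ` closure (\<Union>i. dyadic_grid i) \<subseteq> A \<inter> strongly_convex_segment R x0 x1"
    using cont A closed_strongly_convex_segment[of R x0 x1] unfolding closure_dyadic_grid[symmetric]
    by (intro image_closure_subset closed_Int) (simp_all add: proximally_smooth_def)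
  then have img: "F ` {0..1} \<subseteq> A \<inter> strongly_convex_segment R x0 x1" unfolding closure_dyadic_grid .
  have grid01: "0 \<in> dyadic_grid 0" "1 \<in> dyadic_grid 0"
    unfolding dyadic_grid_def by (rule CollectI, rule exI[of _ 0], simp, rule CollectI, rule exI[of _ 1], simp)
  have "0 \<in> (\<Union>i. dyadic_grid i)" "1 \<in> (\<Union>i. dyadic_grid i)"
    by (rule UN_I[of 0], simp, fact grid01)+
  then have F01: "F 0 = x0" "F 1 = x1" using F(2) f01 by simp_all
  have len: "curve_length F 0 1 \<le> ennreal (2 * R * arcsin (dist x0 x1 / (2 * R)))"
    using curve_length_lipschitz[OF F(1)] by (simp add: C_def \<theta>_def)
  show "\<exists>F. (\<forall>t \<in> (\<Union>i. dyadic_grid i). F t = f t) \<and> continuous_on {0..1} F \<and>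
      F ` {0..1} \<subseteq> A \<inter> strongly_convex_segment R x0 x1 \<and> F 0 = x0 \<and> F 1 = x1 \<and>
      curve_length F 0 1 < \<infinity> \<and>
      curve_length F 0 1 \<le> ennreal (2 * R * arcsin (dist x0 x1 / (2 * R)))"
  proof (intro exI[of _ F] conjI ballI)
    show "curve_length F 0 1 < \<infinity>" using le_less_trans[OF len] by simp
  qed (fact F(2) cont img F01 len)+
qed

end
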